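(* The spaces $(\mathfrak D,\diamond)$ and $(\mathfrak D,\sqcup\!\sqcup)$ are commutative $\mathbb F_q$-algebras (with unit the empty word).
   Context: Let $q$ be a prime power. Let $\Gamma=\{x_{n,\varepsilon}\}_{n\in\mathbb N,\varepsilon\in\mathbb F_q^*}$ be an alphabet with weights $w(x_{n,\varepsilon})=n$, $\langle\Gamma\rangle$ the set of words over $\Gamma$ (empty word $1$, juxtaposition = concatenation) and $\mathfrak D$ the $\mathbb F_q$-vector space with basis $\langle\Gamma\rangle$; write $x_n:=x_{n,1}$. For positive integers $r,s,j$ put $\Delta^j_{r,s}=(-1)^{r-1}\binom{j-1}{r-1}+(-1)^{s-1}\binom{j-1}{s-1}$ if $(q-1)\mid j$ and $0$ otherwise. The bilinear products $\diamond,\sqcup\!\sqcup$ on $\mathfrak D$ are defined recursively by $1\diamond\mathfrak a=\mathfrak a\diamond1=\mathfrak a$, $1\sqcup\!\sqcup\mathfrak a=\mathfrak a\sqcup\!\sqcup1=\mathfrak a$ and, for nonempty words $\mathfrak a=x_{a,\alpha}\mathfrak a_-$, $\mathfrak b=x_{b,\beta}\mathfrak b_-$: $\mathfrak a\diamond\mathfrak b=x_{a+b,\alpha\beta}(\mathfrak a_-\sqcup\!\sqcup\mathfrak b_-)+\sum_{i+j=a+b}\Delta^j_{a,b}x_{i,\alpha\beta}(x_j\sqcup\!\sqcup(\mathfrak a_-\sqcup\!\sqcup\mathfrak b_-))$ and $\mathfrak a\sqcup\!\sqcup\mathfrak b=x_{a,\alpha}(\mathfrak a_-\sqcup\!\sqcup\mathfrak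 b)+x_{b,\beta}(\mathfrak a\sqcup\!\sqcup\mathfrak b_-)+\mathfrak a\diamond\mathfrak b$ ($i,j$ positive integers). *)

theory Defs
  imports "HOL-Library.Poly_Mapping" "HOL-Library.Cardinality"
begin

text \<open>The field F_q is modelled by a finite field type 'a, with q = CARD('a).
 Letters x_{n,e} (n \<ge> 1, e \<noteq> 0) form a type; words are lists of letters;
 the space D is the space of finitely supported 'a-valued functions on words.\<close>

typedef (overloaded) ('a::field) letter = "{(n::nat, e::'a). 1 \<le> n \<and> e \<noteq> 0}"
  morphisms rep_letter Abs_letter
  by (rule exI[of _ "(1, 1)"]) simp

definition wt :: "'a::field letter \<Rightarrow> nat" where "wt x = fst (rep_letter x)"
definition sg :: "'a::field letter \<Rightarrow> 'a" where "sg x = snd (rep_letter x)"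
definition xl :: "nat \<Rightarrow> 'a::field \<Rightarrow> 'a letter" where "xl n e = Abs_letter (n, e)"

type_synonym 'a word = "'a letter list"
type_synonym 'a D = "'a word \<Rightarrow>\<^sub>0 'a"

definition Delta :: "nat \<Rightarrow> nat \<Rightarrow> nat \<Rightarrow> 'a::{field,finite}" where
  "Delta r s j = (if (CARD('a) - 1) dvd j
      then of_int ((-1) ^ (r - 1) * int ((j - 1) choose (r - 1))
                 + (-1) ^ (s - 1) * int ((j - 1) choose (s - 1)))
      else 0)"

definition scal :: "'a::field \<Rightarrow> 'a D \<Rightarrow> 'a D" where
  "scal c p = Poly_Mapping.map (\<lambda>v. c * v) p"

definition pre :: "'a::field letter \<Rightarrow> 'a D \<Rightarrow> 'a D" where
  "pre x p = (\<Sum>w\<in>Poly_Mapping.keys p. Poly_Mapping.single (x # w) (Poly_Mapping.lookup p w))"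

definition bilin :: "('a::field word \<Rightarrow> 'a word \<Rightarrow> 'a D) \<Rightarrow> 'a D \<Rightarrow> 'a D \<Rightarrow> 'a D" where
  "bilin f p r = (\<Sum>u\<in>Poly_Mapping.keys p. \<Sum>v\<in>Poly_Mapping.keys r. scal (Poly_Mapping.lookup p u * Poly_Mapping.lookup r v) (f u v))"

definition dmStep :: "('a::{field,finite} word \<Rightarrow> 'a word \<Rightarrow> 'a D)
     \<Rightarrow> 'a letter \<Rightarrow> 'a word \<Rightarrow> 'a letter \<Rightarrow> 'a word \<Rightarrow> 'a D" where
  "dmStep S x a' y b' =
     (let a = wt x; b = wt y; e = sg x * sg y; t = S a' b' in
       pre (xl (a + b) e) t
       + (\<Sum>j\<in>{1..<a+b}. scal (Delta a b j)
             (pre (xl (a + b - j) e) (bilin S (Poly_Mapping.single [xl j 1] 1) t))))"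

text \<open>The mutual recursion is nested (the diamond calls the shuffle on its own output),
  so we define it with a fuel parameter; fuel = total length of the two words suffices.\<close>
fun shF :: "nat \<Rightarrow> 'a::{field,finite} word \<Rightarrow> 'a word \<Rightarrow> 'a D" where
  "shF n [] b = Poly_Mapping.single b 1"
| "shF n (x # a') [] = Poly_Mapping.single (x # a') 1"
| "shF 0 (x # a') (y # b') = 0"
| "shF (Suc n) (x # a') (y # b') =
     pre x (shF n a' (y # b')) + pre y (shF n (x # a') b') + dmStep (shF n) x a' y b'"

fun dmF :: "nat \<Rightarrow> 'a::{field,finite} word \<Rightarrow> 'a word \<Rightarrow> 'a D" where
  "dmF n [] b = Poly_Mapping.single b 1"
| "dmF n (x # a') [] = Poly_Mapping.single (x # a') 1"
| "dmF 0 (x # a') (y # b') = 0"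
| "dmF (Suc n) (x # a') (y # b') = dmStep (shF n) x a' y b'"

definition shw :: "'a::{field,finite} word \<Rightarrow> 'a word \<Rightarrow> 'a D" where
  "shw u v = shF (length u + length v) u v"
definition dmw :: "'a::{field,finite} word \<Rightarrow> 'a word \<Rightarrow> 'a D" where
  "dmw u v = dmF (length u + length v) u v"

definition shuffle :: "'a::{field,finite} D \<Rightarrow> 'a D \<Rightarrow> 'a D" where
  "shuffle = bilin shw"
definition diamond :: "'a::{field,finite} D \<Rightarrow> 'a D \<Rightarrow> 'a D" where
  "diamond = bilin dmw"

definition unitD :: "'a::field D" where "unitD = Poly_Mapping.single [] 1"

definition comm_algebra :: "('a::field D \<Rightarrow> 'a D \<Rightarrow> 'a D) \<Rightarrow> 'a D \<Rightarrow> bool" where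
  "comm_algebra mul one \<longleftrightarrow>
     (\<forall>p r s. mul (mul p r) s = mul p (mul r s)) \<and>
     (\<forall>p r. mul p r = mul r p) \<and>
     (\<forall>p. mul one p = p \<and> mul p one = p) \<and>
     (\<forall>p r s. mul (p + r) s = mul p s + mul r s \<and> mul s (p + r) = mul s p + mul s r) \<and>
     (\<forall>c p r. mul (scal c p) r = scal c (mul p r) \<and> mul p (scal c r) = scal c (mul p r))"

end

theory Submission
  imports Defs "HOL-Computational_Algebra.Computational_Algebra"
begin

text \<open>Let \<open>L\<close> be an infinite field containing \<open>F_q\<close>. Elements \<open>\<theta>_0, \<dots>, \<theta>_d\<close> of \<open>L\<close> that are linearly
  independent over \<open>F_q\<close> play the role of the powers \<open>1, \<theta>, \<dots>, \<theta>^d\<close> in the power sums of Carlitz and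
  Thakur: with \<open>V_d\<close> the span of \<open>\<theta>_0, \<dots>, \<theta>_(d-1)\<close>, send \<open>x_(n,e)\<close> to
  \<open>S_d(x_(n,e)) = e^(k_d) * (\<Sum>v\<in>V_d. (\<theta>_d + v)^(-n))\<close> for an arbitrary exponent \<open>k_d\<close>, and extend to words
  by \<open>S_d(x w) = S_d(x) S_(<d)(w)\<close>, where \<open>S_(<d)(w)\<close> is the sum of the \<open>S_i(w)\<close> over \<open>i < d\<close>.
  Partial fractions for \<open>(\<theta>_d + v)^(-a) (\<theta>_d + w)^(-b)\<close> show that \<open>S_(<d)\<close> is multiplicative for the
  shuffle product and \<open>S_d\<close> for the diamond product. As functions of \<open>\<theta>_d\<close> the sums have poles of
  distinct orders at \<open>0\<close>, and the characters \<open>e \<mapsto> e^k\<close> separate the signs, so these functionals, taken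
  over all choices of \<open>\<theta>_i\<close> and \<open>k_i\<close>, vanish simultaneously only at \<open>0\<close>. Hence every algebra identity
  is inherited from \<open>L\<close>.\<close>

section \<open>Partial fractions and power sums\<close>

text \<open>For \<open>F = 1/(\<theta> + v)\<close>, \<open>G = 1/(\<theta> + w)\<close> and
  \<open>H = 1/(v - w)\<close> the assumption is the simplest partial fraction decomposition. Each
  induction step trades one factor \<open>F * G\<close> for \<open>H * (G - F)\<close>, which lowers
  the total exponent; the coefficients then combine by Pascal's rule.\<close>

lemma partial_fraction_powers:
  fixes F G H :: "'b::comm_ring_1"
  assumes "F * G = H * (G - F)"
  shows "F ^ Suc a * G ^ Suc b = (\<Sum>j\<le>a + b.
      ((- 1) ^ (j + a) * of_nat (j choose a) * G ^ (a + b + 1 - j)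
       + (- 1) ^ Suc b * of_nat (j choose b) * F ^ (a + b + 1 - j)) * H ^ Suc j)"
proof (induction "a + b" arbitrary: a b)
  case 0
  then show ?case using assms by (simp add: algebra_simps)
next
  case (Suc n)
  define T where "T a b j = ((- 1) ^ (j + a) * of_nat (j choose a) * G ^ (a + b + 1 - j)
       + (- 1) ^ Suc b * of_nat (j choose b) * F ^ (a + b + 1 - j)) * H ^ Suc j" for a b j :: nat
  have split0: "(\<Sum>j\<le>Suc n. T a b j) = T a b 0 + (\<Sum>j\<le>n. T a b (Suc j))"
    by (rule sum.atMost_Suc_shift)
  have "F ^ Suc a * G ^ Suc b = (\<Sum>j\<le>Suc n. T a b j)"
  proof (cases a)
    case a: 0
    obtain b' where b: "b = Suc b'" using Suc a by (cases b) auto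
    have IH: "F ^ Suc 0 * G ^ Suc b' = (\<Sum>j\<le>n. T 0 b' j)"
      using Suc.hyps(1)[of 0 b'] Suc.hyps(2) a b by (simp add: T_def)
    have "F ^ Suc a * G ^ Suc b = (F * G) * G ^ Suc b'" using a b by simp
    also have "\<dots> = H * G ^ Suc b - H * (F ^ Suc 0 * G ^ Suc b')"
      unfolding assms using b by (simp add: algebra_simps)
    also have "\<dots> = H * G ^ Suc b - (\<Sum>j\<le>n. H * T 0 b' j)"
      by (simp only: IH sum_distrib_left)
    also have "\<dots> = T a b 0 + (\<Sum>j\<le>n. T a b (Suc j))"
    proof -
      have "T a b 0 = H * G ^ Suc b" using a b by (simp add: T_def)
      \<comment> \<open>The \<open>F\<close> terms carry a binomial coefficient that vanishes for
        \<open>j < b'\<close>, so on both sides only the one at \<open>j = b'\<close> survives. The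
        case \<open>b = 0\<close> below is the mirror image.\<close>
      moreover have "T a b (Suc j) = - (H * T 0 b' j)" if "j \<le> n" for j
        using that Suc.hyps(2) a b by (cases "j < b'") (auto simp: T_def binomial_eq_0 algebra_simps)
      ultimately show ?thesis by (simp add: sum_negf)
    qed
    finally show ?thesis by (simp only: split0)
  next
    case a: (Suc a')
    show ?thesis
    proof (cases b)
      case b: 0
      have IH: "F ^ Suc a' * G ^ Suc 0 = (\<Sum>j\<le>n. T a' 0 j)"
        using Suc.hyps(1)[of a' 0] Suc.hyps(2) a b by (simp add: T_def)
      have "F ^ Suc a * G ^ Suc b = (F * G) * F ^ Suc a'" using a b by (simp add: algebra_simps)
      also have "\<dots> = H * (F ^ Suc a' * G ^ Suc 0) - H * F ^ Suc a"
        unfolding assms using a by (simp add: algebra_simps)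
      also have "\<dots> = (\<Sum>j\<le>n. H * T a' 0 j) - H * F ^ Suc a"
        by (simp only: IH sum_distrib_left)
      also have "\<dots> = T a b 0 + (\<Sum>j\<le>n. T a b (Suc j))"
      proof -
        have "T a b 0 = - (H * F ^ Suc a)" using a b by (simp add: T_def algebra_simps)
        moreover have "T a b (Suc j) = H * T a' 0 j" if "j \<le> n" for j
          using that Suc.hyps(2) a b by (cases "j < a'") (auto simp: T_def binomial_eq_0 algebra_simps)
        ultimately show ?thesis by simp
      qed
      finally show ?thesis by (simp only: split0)
    next
      case b: (Suc b')
      have IH1: "F ^ Suc a' * G ^ Suc b = (\<Sum>j\<le>n. T a' b j)"
        using Suc.hyps(1)[of a' b] Suc.hyps(2) a by (simp add: T_def)
      have IH2: "F ^ Suc a * G ^ Suc b' = (\<Sum>j\<le>n. T a b' j)"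
        using Suc.hyps(1)[of a b'] Suc.hyps(2) b by (simp add: T_def)
      have "F ^ Suc a * G ^ Suc b = (F * G) * (F ^ Suc a' * G ^ Suc b')"
        using a b by (simp add: algebra_simps)
      also have "\<dots> = H * (F ^ Suc a' * G ^ Suc b) - H * (F ^ Suc a * G ^ Suc b')"
        unfolding assms using a b by (simp add: algebra_simps)
      also have "\<dots> = (\<Sum>j\<le>n. H * T a' b j - H * T a b' j)"
        by (simp only: IH1 IH2 sum_distrib_left sum_subtractf)
      also have "\<dots> = T a b 0 + (\<Sum>j\<le>n. T a b (Suc j))"
      proof -
        have "T a b 0 = 0" using a b by (simp add: T_def)
        moreover have "T a b (Suc j) = H * T a' b j - H * T a b' j" if "j \<le> n" for j
          using that Suc.hyps(2) a b by (simp add: T_def algebra_simps)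
        ultimately show ?thesis by simp
      qed
      finally show ?thesis by (simp only: split0)
    qed
  qed
  then show ?case using Suc.hyps(2) by (simp add: T_def)
qed

section \<open>Power sums over the units of a finite field\<close>

lemma finite_field_power_card_minus_one:
  fixes x :: "'a::{field,finite}"
  assumes "x \<noteq> 0"
  shows "x ^ (CARD('a) - 1) = 1"
proof -
  have "(\<Prod>y\<in>- {0::'a}. y) = (\<Prod>y\<in>- {0::'a}. x * y)"
    by (rule prod.reindex_bij_witness[of _ "\<lambda>y. x * y" "\<lambda>y. inverse x * y"])
      (use assms in \<open>auto simp: field_simps\<close>)
  also have "\<dots> = x ^ (CARD('a) - 1) * (\<Prod>y\<in>- {0::'a}. y)"
    by (simp add: prod.distrib Compl_eq_Diff_UNIV card_Diff_subset)
  finally show ?thesis by simp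
qed

lemma of_nat_CARD_field: "of_nat (CARD('a)) = (0 :: 'a::{field,finite})"
proof -
  have "(\<Sum>x\<in>(UNIV::'a set). x) = (\<Sum>x\<in>(UNIV::'a set). x + 1)"
    by (rule sum.reindex_bij_witness[of _ "\<lambda>x. x + 1" "\<lambda>x. x - 1"]) auto
  then show ?thesis by (simp add: sum.distrib)
qed

text \<open>Source of the divisibility condition in \<open>Delta\<close>. If q - 1 divides
  \<open>j\<close>, all q - 1 summands are 1; otherwise rescaling by a unit \<open>x\<close> with
  \<open>x ^ j \<noteq> 1\<close> multiplies the sum by \<open>x ^ j\<close> without changing
  it.\<close>

lemma sum_units_power:
  "(\<Sum>c\<in>- {0::'a::{field,finite}}. inverse c ^ j) = (if (CARD('a) - 1) dvd j then - 1 else 0)"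
proof -
  have q2: "CARD('a) \<ge> 2" using card_mono[of UNIV "{0, 1::'a}"] by simp
  show ?thesis
  proof (cases "(CARD('a) - 1) dvd j")
    case True
    then obtain k where k: "j = (CARD('a) - 1) * k" by blast
    have "(\<Sum>c\<in>- {0::'a}. inverse c ^ j) = (\<Sum>c\<in>- {0::'a}. 1)"
      by (rule sum.cong) (auto simp: k power_mult finite_field_power_card_minus_one simp del: One_nat_def)
    also have "\<dots> = of_nat (CARD('a) - 1)" by (simp add: Compl_eq_Diff_UNIV card_Diff_subset)
    also have "\<dots> = - 1" using q2 by (simp add: of_nat_diff of_nat_CARD_field)
    finally show ?thesis using True by simp
  next
    case False
    \<comment> \<open>After reduction modulo q - 1, the polynomial X^r - 1 has degree below the
      number of units, so some unit is not a root.\<close>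
    define r where "r = j mod (CARD('a) - 1)"
    have r: "0 < r" "r < CARD('a) - 1" using False q2 by (auto simp: r_def mod_greater_zero_iff_not_dvd)
    have pw: "x ^ j = x ^ r" if "x \<noteq> 0" for x :: 'a
    proof -
      have "x ^ j = x ^ ((CARD('a) - 1) * (j div (CARD('a) - 1)) + r)" by (simp add: r_def)
      also have "\<dots> = x ^ r"
        by (simp add: power_add power_mult finite_field_power_card_minus_one[OF that] del: One_nat_def)
      finally show ?thesis .
    qed
    have "\<exists>x::'a. x \<noteq> 0 \<and> x ^ r \<noteq> 1"
    proof (rule ccontr)
      assume "\<not> ?thesis"
      then have sub: "- {0::'a} \<subseteq> {x. poly (monom 1 r - 1) x = 0}" by (auto simp: poly_monom)
      have nz: "monom 1 r - 1 \<noteq> (0::'a poly)"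
        using r(1) by (metis degree_1 degree_monom_eq eq_iff_diff_eq_0 less_numeral_extra(3) zero_neq_one)
      have "degree (monom 1 r - 1 :: 'a poly) \<le> r"
        by (intro degree_diff_le) (auto simp: degree_monom_le)
      then have "card {x. poly (monom 1 r - 1 :: 'a poly) x = 0} \<le> r"
        using card_poly_roots_bound[OF nz] by linarith
      moreover have "card (- {0::'a}) \<le> card {x. poly (monom 1 r - 1 :: 'a poly) x = 0}"
        by (rule card_mono[OF poly_roots_finite[OF nz] sub])
      ultimately show False using r by (simp add: Compl_eq_Diff_UNIV card_Diff_subset)
    qed
    then obtain x :: 'a where x: "x \<noteq> 0" "x ^ r \<noteq> 1" by blast
    have "(\<Sum>c\<in>- {0::'a}. inverse c ^ j) = (\<Sum>c\<in>- {0::'a}. x ^ j * inverse c ^ j)"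
      by (rule sum.reindex_bij_witness[of _ "\<lambda>c. inverse x * c" "\<lambda>c. x * c"])
        (use x in \<open>auto simp: field_simps\<close>)
    also have "\<dots> = x ^ j * (\<Sum>c\<in>- {0::'a}. inverse c ^ j)" by (simp add: sum_distrib_left)
    finally show ?thesis using x pw[of x] False by (metis mult_cancel_right1)
  qed
qed

text \<open>Vandermonde argument: the equations extend linearly to all polynomials in
  \<open>f x\<close>, and a Lagrange polynomial isolates one node.\<close>

lemma vanishing_power_sums:
  fixes f :: "'i \<Rightarrow> 'b::field"
  assumes fin: "finite A" and inj: "inj_on f A"
    and eq: "\<And>k. (\<Sum>x\<in>A. f x ^ k * C x) = 0" and x: "x \<in> A"
  shows "C x = 0"
proof -
  have *: "(\<Sum>x\<in>A. poly P (f x) * C x) = 0" for P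
  proof -
    have "(\<Sum>x\<in>A. poly P (f x) * C x) = (\<Sum>x\<in>A. \<Sum>i\<le>degree P. coeff P i * (f x ^ i * C x))"
      by (simp add: poly_altdef sum_distrib_right mult.assoc)
    also have "\<dots> = (\<Sum>i\<le>degree P. coeff P i * (\<Sum>x\<in>A. f x ^ i * C x))"
      by (subst sum.swap) (simp add: sum_distrib_left)
    finally show ?thesis by (simp add: eq)
  qed
  define P where "P = (\<Prod>y\<in>A - {x}. [:- f y, 1:])"
  have "poly P (f y) = 0" if "y \<in> A - {x}" for y
    using that fin by (auto simp: P_def poly_prod intro!: prod_zero)
  then have "(\<Sum>y\<in>A. poly P (f y) * C y) = poly P (f x) * C x"
    using fin x by (simp add: sum.remove)
  moreover have "poly P (f x) \<noteq> 0"
    using fin inj x by (auto simp: P_def poly_prod inj_on_def)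
  ultimately show ?thesis using *[of P] by simp
qed

section \<open>Words and their linear combinations\<close>

lemma lookup_scal [simp]: "Poly_Mapping.lookup (scal c p) w = c * Poly_Mapping.lookup p w"
  by (simp add: scal_def Poly_Mapping.map.rep_eq when_def)

lemma wt_xl_sg_xl [simp]:
  assumes "0 < n" "e \<noteq> 0"
  shows "wt (xl n e) = n" "sg (xl n e) = e"
  using assms by (simp_all add: wt_def sg_def xl_def Abs_letter_inverse)

lemma wt_ge_1: "1 \<le> wt x" and sg_nonzero: "sg x \<noteq> 0"
  using rep_letter[of x] by (auto simp: wt_def sg_def)

lemma letter_eqI: "wt x = wt y \<Longrightarrow> sg x = sg y \<Longrightarrow> x = y"
  by (metis prod.collapse rep_letter_inject sg_def wt_def)

lemma keys_add_subset:
  "Poly_Mapping.keys p \<subseteq> A \<Longrightarrow> Poly_Mapping.keys r \<subseteq> A \<Longrightarrow> Poly_Mapping.keys (p + r) \<subseteq> A"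
  using Poly_Mapping.keys_add[of p r] by blast

lemma keys_sum_subset:
  "(\<And>i. i \<in> I \<Longrightarrow> Poly_Mapping.keys (g i) \<subseteq> A) \<Longrightarrow> Poly_Mapping.keys (sum g I) \<subseteq> A"
  using Poly_Mapping.keys_sum[of g I] by blast

lemma keys_scal_subset: "Poly_Mapping.keys p \<subseteq> A \<Longrightarrow> Poly_Mapping.keys (scal c p) \<subseteq> A"
  by (auto simp: in_keys_iff subset_iff)

lemma keys_pre_subset:
  assumes "Poly_Mapping.keys p \<subseteq> {w. length w \<le> m}"
  shows "Poly_Mapping.keys (pre x p) \<subseteq> {w. length w \<le> Suc m}"
  unfolding pre_def by (rule keys_sum_subset) (use assms in auto)

lemma keys_bilin_subset:
  assumes "\<And>u v. u \<in> Poly_Mapping.keys p \<Longrightarrow> v \<in> Poly_Mapping.keys r \<Longrightarrow> Poly_Mapping.keys (f u v) \<subseteq> A"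
  shows "Poly_Mapping.keys (bilin f p r) \<subseteq> A"
  unfolding bilin_def by (intro keys_sum_subset keys_scal_subset assms)

lemma keys_dmStep_subset:
  assumes S: "\<And>u v. Poly_Mapping.keys (S u v) \<subseteq> {w. length w \<le> length u + length v}"
  shows "Poly_Mapping.keys (dmStep S x a y b) \<subseteq> {w. length w \<le> Suc (Suc (length a + length b))}"
proof -
  have t: "Poly_Mapping.keys (S a b) \<subseteq> {w. length w \<le> Suc (length a + length b)}"
    using S[of a b] by auto
  have "Poly_Mapping.keys (bilin S (Poly_Mapping.single [z] 1) (S a b)) \<subseteq> {w. length w \<le> Suc (length a + length b)}" for z
  proof (rule keys_bilin_subset)
    fix u v
    assume "u \<in> Poly_Mapping.keys (Poly_Mapping.single [z] (1::'a))" "v \<in> Poly_Mapping.keys (S a b)"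
    then have "length u + length v \<le> Suc (length a + length b)" using S[of a b] by auto
    then show "Poly_Mapping.keys (S u v) \<subseteq> {w. length w \<le> Suc (length a + length b)}"
      using S[of u v] by auto
  qed
  then show ?thesis
    unfolding dmStep_def Let_def
    by (intro keys_add_subset keys_sum_subset keys_scal_subset keys_pre_subset t)
qed

text \<open>Ensures that the fuel still suffices when \<open>dmStep\<close> applies the shuffle to
  its own output.\<close>

lemma keys_shF_subset: "Poly_Mapping.keys (shF n u v) \<subseteq> {w. length w \<le> length u + length v}"
proof (induction n u v rule: shF.induct)
  case (4 n x a y b)
  have "Poly_Mapping.keys (shF (Suc n) (x # a) (y # b)) \<subseteq> {w. length w \<le> Suc (Suc (length a + length b))}"
    unfolding shF.simps
    by (intro keys_add_subset keys_pre_subset keys_dmStep_subset)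
      (use "4.IH" in \<open>auto\<close>)
  then show ?case by simp
qed auto

lemma lookup_pre:
  "Poly_Mapping.lookup (pre x p) w = (if w \<noteq> [] \<and> hd w = x then Poly_Mapping.lookup p (tl w) else 0)"
proof (cases w)
  case Nil
  then show ?thesis by (simp add: pre_def lookup_sum lookup_single)
next
  case (Cons y v)
  have "Poly_Mapping.lookup (pre x p) w
      = (\<Sum>u\<in>Poly_Mapping.keys p. if u = v then (if y = x then Poly_Mapping.lookup p v else 0) else 0)"
    unfolding pre_def lookup_sum by (intro sum.cong) (auto simp: lookup_single Cons when_def)
  also have "\<dots> = (if y = x then Poly_Mapping.lookup p v else 0)"
    by (subst sum.delta) (auto simp: in_keys_iff)
  finally show ?thesis by (simp add: Cons)
qed

text \<open>The left quotient by a letter, a left inverse of \<open>pre x\<close>.\<close>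

definition tail :: "'a::field letter \<Rightarrow> 'a D \<Rightarrow> 'a D" where
  "tail x p = Poly_Mapping.map_key ((#) x) p"

lemma lookup_tail [simp]: "Poly_Mapping.lookup (tail x p) w = Poly_Mapping.lookup p (x # w)"
  unfolding tail_def by (subst map_key.rep_eq) simp_all

lemma decompose_by_first_letter:
  assumes "finite X" "\<And>x w. x # w \<in> Poly_Mapping.keys p \<Longrightarrow> x \<in> X"
  shows "p = Poly_Mapping.single [] (Poly_Mapping.lookup p []) + (\<Sum>x\<in>X. pre x (tail x p))"
proof (rule poly_mapping_eqI)
  fix w
  show "Poly_Mapping.lookup p w = Poly_Mapping.lookup
      (Poly_Mapping.single [] (Poly_Mapping.lookup p []) + (\<Sum>x\<in>X. pre x (tail x p))) w"
  proof (cases w)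
    case Nil
    then show ?thesis by (simp add: lookup_add lookup_sum lookup_pre)
  next
    case (Cons y v)
    have "(\<Sum>x\<in>X. Poly_Mapping.lookup (pre x (tail x p)) w)
        = (\<Sum>x\<in>X. if x = y then Poly_Mapping.lookup p (y # v) else 0)"
      by (intro sum.cong) (auto simp: Cons lookup_pre)
    also have "\<dots> = Poly_Mapping.lookup p w"
      using assms by (subst sum.delta) (auto simp: Cons in_keys_iff)
    finally show ?thesis by (simp add: Cons lookup_add lookup_sum lookup_single)
  qed
qed

section \<open>Multiplicative functionals\<close>

text \<open>A unital ring homomorphism between fields is injective, so \<open>\<iota>\<close> embeds
  F_q. Since spans are finite, an infinite target leaves infinitely many \<open>\<theta>\<close>
  outside each of them.\<close>

locale field_extension =
  fixes \<iota> :: "'a::{field,finite} \<Rightarrow> 'b::field"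
  assumes \<iota>_add: "\<iota> (x + y) = \<iota> x + \<iota> y"
    and \<iota>_mult: "\<iota> (x * y) = \<iota> x * \<iota> y"
    and \<iota>_1: "\<iota> 1 = 1"
    and infinite_UNIV: "infinite (UNIV :: 'b set)"
begin

lemma \<iota>_0: "\<iota> 0 = 0"
  using \<iota>_add[of 0 0] by (metis add.right_neutral add_left_imp_eq)

lemma \<iota>_eq_0_iff: "\<iota> x = 0 \<longleftrightarrow> x = 0"
proof
  assume "\<iota> x = 0"
  then have "\<iota> (x * inverse x) = 0" by (simp add: \<iota>_mult)
  then show "x = 0" using \<iota>_1 by (cases "x = 0") auto
qed (simp add: \<iota>_0)

lemma \<iota>_uminus: "\<iota> (- x) = - \<iota> x"
  using \<iota>_add[of x "- x"] by (simp add: \<iota>_0 eq_neg_iff_add_eq_0 add.commute)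

lemma \<iota>_diff: "\<iota> (x - y) = \<iota> x - \<iota> y"
  using \<iota>_add[of x "- y"] by (simp add: \<iota>_uminus)

lemma \<iota>_eq_iff: "\<iota> x = \<iota> y \<longleftrightarrow> x = y"
  using \<iota>_eq_0_iff[of "x - y"] by (simp add: \<iota>_diff)

lemma \<iota>_power: "\<iota> (x ^ n) = \<iota> x ^ n"
  by (induction n) (simp_all add: \<iota>_1 \<iota>_mult)

lemma \<iota>_inverse: "\<iota> (inverse x) = inverse (\<iota> x)"
proof (cases "x = 0")
  case False
  then have "\<iota> x * \<iota> (inverse x) = 1" by (simp flip: \<iota>_mult add: \<iota>_1)
  then show ?thesis by (metis inverse_unique)
qed (simp add: \<iota>_0)

lemma \<iota>_of_nat: "\<iota> (of_nat n) = of_nat n"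
  by (induction n) (simp_all add: \<iota>_0 \<iota>_1 \<iota>_add)

lemma \<iota>_sum: "\<iota> (sum f A) = (\<Sum>x\<in>A. \<iota> (f x))"
  by (induction A rule: infinite_finite_induct) (simp_all add: \<iota>_0 \<iota>_add)

section \<open>Linear extension of functions on words\<close>

definition lin :: "('a word \<Rightarrow> 'b) \<Rightarrow> 'a D \<Rightarrow> 'b" where
  "lin \<phi> p = (\<Sum>w\<in>Poly_Mapping.keys p. \<iota> (Poly_Mapping.lookup p w) * \<phi> w)"

lemma lin_superset:
  assumes "finite A" "Poly_Mapping.keys p \<subseteq> A"
  shows "lin \<phi> p = (\<Sum>w\<in>A. \<iota> (Poly_Mapping.lookup p w) * \<phi> w)"
  unfolding lin_def using assms
  by (intro sum.mono_neutral_left) (auto simp: in_keys_iff \<iota>_0)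

lemma lin_0 [simp]: "lin \<phi> 0 = 0"
  by (simp add: lin_def)

lemma lin_add: "lin \<phi> (p + r) = lin \<phi> p + lin \<phi> r"
proof -
  have "Poly_Mapping.keys (p + r) \<subseteq> Poly_Mapping.keys p \<union> Poly_Mapping.keys r"
    by (rule Poly_Mapping.keys_add)
  then show ?thesis
    by (simp add: lin_superset[of "Poly_Mapping.keys p \<union> Poly_Mapping.keys r"]
        lookup_add \<iota>_add distrib_right sum.distrib)
qed

lemma lin_scal: "lin \<phi> (scal c p) = \<iota> c * lin \<phi> p"
  using lin_superset[OF finite_keys keys_scal_subset[OF subset_refl], of \<phi> c p]
  by (simp add: lin_def \<iota>_mult sum_distrib_left mult.assoc)

lemma lin_diff: "lin \<phi> (p - r) = lin \<phi> p - lin \<phi> r"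
  using lin_add[of \<phi> "p - r" r] by simp

lemma lin_sum: "lin \<phi> (sum g A) = (\<Sum>x\<in>A. lin \<phi> (g x))"
  by (induction A rule: infinite_finite_induct) (simp_all add: lin_add)

lemma lin_single [simp]: "lin \<phi> (Poly_Mapping.single w c) = \<iota> c * \<phi> w"
  by (cases "c = 0") (simp_all add: lin_def \<iota>_0)

lemma lin_pre: "lin \<phi> (pre x p) = lin (\<lambda>w. \<phi> (x # w)) p"
  unfolding pre_def lin_sum lin_single by (simp add: lin_def)

lemma lin_fun_add: "lin (\<lambda>w. \<phi> w + \<psi> w) p = lin \<phi> p + lin \<psi> p"
  by (simp add: lin_def distrib_left sum.distrib)

lemma lin_fun_cmult: "lin (\<lambda>w. c * \<phi> w) p = c * lin \<phi> p"
  by (simp add: lin_def sum_distrib_left mult_ac)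

text \<open>The assumption is restricted to words occurring in \<open>p\<close> and \<open>r\<close>
  because \<open>shF n\<close> is only known to be multiplicative on words of total length at most
  \<open>n\<close>.\<close>

lemma lin_bilin:
  assumes "\<And>u v. u \<in> Poly_Mapping.keys p \<Longrightarrow> v \<in> Poly_Mapping.keys r \<Longrightarrow> lin \<phi> (f u v) = \<phi> u * \<phi> v"
  shows "lin \<phi> (bilin f p r) = lin \<phi> p * lin \<phi> r"
proof -
  have "lin \<phi> (bilin f p r) = (\<Sum>u\<in>Poly_Mapping.keys p. \<Sum>v\<in>Poly_Mapping.keys r.
      \<iota> (Poly_Mapping.lookup p u * Poly_Mapping.lookup r v) * lin \<phi> (f u v))"
    by (simp add: bilin_def lin_sum lin_scal)
  also have "\<dots> = (\<Sum>u\<in>Poly_Mapping.keys p. \<Sum>v\<in>Poly_Mapping.keys r.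
      (\<iota> (Poly_Mapping.lookup p u) * \<phi> u) * (\<iota> (Poly_Mapping.lookup r v) * \<phi> v))"
    by (intro sum.cong refl) (simp add: assms \<iota>_mult mult_ac)
  also have "\<dots> = lin \<phi> p * lin \<phi> r"
    by (simp add: lin_def sum_product)
  finally show ?thesis .
qed

text \<open>Every functional carries both sides of an algebra law to equal elements of the
  commutative target field; separation pulls the equality back.\<close>

lemma comm_algebra_bilinI:
  assumes mult: "\<And>\<phi> u v. \<phi> \<in> \<Phi> \<Longrightarrow> lin \<phi> (f u v) = \<phi> u * \<phi> v"
    and one: "\<And>\<phi>. \<phi> \<in> \<Phi> \<Longrightarrow> \<phi> [] = 1"
    and sep: "\<And>p. (\<And>\<phi>. \<phi> \<in> \<Phi> \<Longrightarrow> lin \<phi> p = 0) \<Longrightarrow> p = 0"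
  shows "comm_algebra (bilin f) unitD"
proof -
  have eqI: "p = r" if "\<And>\<phi>. \<phi> \<in> \<Phi> \<Longrightarrow> lin \<phi> p = lin \<phi> r" for p r
    using sep[of "p - r"] that by (simp add: lin_diff)
  have b: "lin \<phi> (bilin f p r) = lin \<phi> p * lin \<phi> r" if "\<phi> \<in> \<Phi>" for \<phi> p r
    by (rule lin_bilin) (rule mult[OF that])
  have u: "lin \<phi> unitD = 1" if "\<phi> \<in> \<Phi>" for \<phi>
    by (simp add: unitD_def one[OF that] \<iota>_1)
  show ?thesis
    unfolding comm_algebra_def
    by (intro conjI allI; rule eqI) (simp_all add: b u lin_add lin_scal algebra_simps)
qed

text \<open>A list of pairs \<open>(\<theta>_i, k_i)\<close> is stored with the last one, \<open>i = d - 1\<close>, at its head.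
  For such a list \<open>ts\<close>, \<open>span ts\<close> is \<open>V_d\<close>, \<open>ev ts\<close> is \<open>S_(<d)\<close>, and \<open>top_ev \<theta>_d k_d ts\<close> is \<open>S_d\<close>.\<close>

fun span :: "('b \<times> nat) list \<Rightarrow> 'b set" where
  "span [] = {0}"
| "span ((\<theta>, k) # ts) = (\<lambda>(c, v). \<iota> c * \<theta> + v) ` (UNIV \<times> span ts)"

fun independent :: "('b \<times> nat) list \<Rightarrow> bool" where
  "independent [] = True"
| "independent ((\<theta>, k) # ts) = (\<theta> \<notin> span ts \<and> independent ts)"

lemma finite_span: "finite (span ts)"
  by (induction ts rule: span.induct) auto

lemma zero_in_span: "0 \<in> span ts"
  by (induction ts rule: span.induct) (auto simp: \<iota>_0 intro: image_eqI[of _ _ "(0, 0)"])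

lemma span_diff: "u \<in> span ts \<Longrightarrow> v \<in> span ts \<Longrightarrow> u - v \<in> span ts"
proof (induction ts arbitrary: u v rule: span.induct)
  case (2 \<theta> k ts)
  from 2(2) obtain c u' where u: "u = \<iota> c * \<theta> + u'" "u' \<in> span ts" by auto
  from 2(3) obtain d v' where v: "v = \<iota> d * \<theta> + v'" "v' \<in> span ts" by auto
  have "u - v = \<iota> (c - d) * \<theta> + (u' - v')" by (simp add: u v \<iota>_diff algebra_simps)
  then show ?case using 2(1)[OF u(2) v(2)] by (force simp: image_iff)
qed auto

lemma span_scale: "u \<in> span ts \<Longrightarrow> \<iota> c * u \<in> span ts"
proof (induction ts arbitrary: u rule: span.induct)
  case (2 \<theta> k ts)
  from 2(2) obtain d u' where u: "u = \<iota> d * \<theta> + u'" "u' \<in> span ts" by auto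
  have "\<iota> c * u = \<iota> (c * d) * \<theta> + \<iota> c * u'" by (simp add: u \<iota>_mult algebra_simps)
  then show ?case using 2(1)[OF u(2)] by (force simp: image_iff)
qed auto

lemma span_uminus: "u \<in> span ts \<Longrightarrow> - u \<in> span ts"
  using span_diff[OF zero_in_span] by fastforce

lemma span_add: "u \<in> span ts \<Longrightarrow> v \<in> span ts \<Longrightarrow> u + v \<in> span ts"
  using span_diff[of u ts "- v"] span_uminus by simp

section \<open>Power sums and their product formula\<close>

definition powsum :: "'b \<Rightarrow> ('b \<times> nat) list \<Rightarrow> nat \<Rightarrow> 'b" where
  "powsum \<theta> ts n = (\<Sum>v\<in>span ts. inverse (\<theta> + v) ^ n)"

definition chi :: "'b \<Rightarrow> nat \<Rightarrow> ('b \<times> nat) list \<Rightarrow> 'a letter \<Rightarrow> 'b" where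
  "chi \<theta> k ts x = \<iota> (sg x) ^ k * powsum \<theta> ts (wt x)"

text \<open>The recursion asks whether the first letter uses the newest index; if so, all later
  letters use strictly smaller ones. Without any index a nonempty word has an empty sum.\<close>

fun ev :: "('b \<times> nat) list \<Rightarrow> 'a word \<Rightarrow> 'b" where
  "ev ts [] = 1"
| "ev [] (x # w) = 0"
| "ev ((\<theta>, k) # ts) (x # w) = ev ts (x # w) + chi \<theta> k ts x * ev ts w"

fun top_ev :: "'b \<Rightarrow> nat \<Rightarrow> ('b \<times> nat) list \<Rightarrow> 'a word \<Rightarrow> 'b" where
  "top_ev \<theta> k ts [] = 1"
| "top_ev \<theta> k ts (x # w) = chi \<theta> k ts x * ev ts w"

text \<open>Every nonzero element of the span is a scalar multiple of exactly one monic one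
  (leading coefficient 1 in the \<open>\<theta>_i\<close>), and \<open>ev ts [xl j 1]\<close> sums over the monic ones.\<close>

lemma sum_span_nonzero:
  assumes "independent ts" "j \<ge> 1"
  shows "(\<Sum>u\<in>span ts - {0}. inverse u ^ j)
    = (if (CARD('a) - 1) dvd j then - ev ts [xl j 1] else 0)"
  using assms
proof (induction ts rule: span.induct)
  case (2 \<theta> k ts)
  have \<theta>: "\<theta> \<notin> span ts" and ind: "independent ts" using 2 by auto
  have nz: "\<iota> c * \<theta> + v \<noteq> 0" if "c \<noteq> 0" "v \<in> span ts" for c v
  proof
    assume "\<iota> c * \<theta> + v = 0"
    then have "v = - (\<iota> c * \<theta>)" by (simp add: add_eq_0_iff)
    then have "\<theta> = \<iota> (- inverse c) * v"
      using that(1) unfolding \<iota>_uminus \<iota>_inverse by (simp add: \<iota>_eq_0_iff)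
    then show False using \<theta> span_scale[OF that(2)] by metis
  qed
  have inj: "inj_on (\<lambda>(c, v). \<iota> c * \<theta> + v) (UNIV \<times> span ts)"
  proof (rule inj_onI, clarsimp)
    fix c v d w
    assume *: "v \<in> span ts" "w \<in> span ts" "\<iota> c * \<theta> + v = \<iota> d * \<theta> + w"
    then have "\<iota> (c - d) * \<theta> + (v - w) = 0" by (simp add: \<iota>_diff algebra_simps)
    then have "c = d" using nz[of "c - d" "v - w"] span_diff[OF *(1,2)] by auto
    then show "c = d \<and> v = w" using * by simp
  qed
  \<comment> \<open>Split by the coefficient \<open>c\<close> of \<open>\<theta>\<close>:
    \<open>c = 0\<close> is left to the induction hypothesis, and \<open>c \<noteq> 0\<close> yields
    the new summand of \<open>ev\<close>.\<close>
  have decomp: "span ((\<theta>, k) # ts) - {0}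
      = (span ts - {0}) \<union> (\<lambda>(c, v). \<iota> c * \<theta> + v) ` ((- {0}) \<times> span ts)" (is "_ = ?A \<union> ?B")
  proof (intro equalityI subsetI)
    fix u assume "u \<in> span ((\<theta>, k) # ts) - {0}"
    then obtain c v where "u = \<iota> c * \<theta> + v" "v \<in> span ts" "u \<noteq> 0" by auto
    then show "u \<in> ?A \<union> ?B" by (cases "c = 0") (auto simp: \<iota>_0)
  next
    fix u assume "u \<in> ?A \<union> ?B"
    then show "u \<in> span ((\<theta>, k) # ts) - {0}"
      using nz by (auto intro: image_eqI[of _ _ "(0, u)"] simp: \<iota>_0)
  qed
  have disj: "?A \<inter> ?B = {}"
  proof -
    have False if "c \<noteq> 0" "v \<in> span ts" "\<iota> c * \<theta> + v \<in> span ts" for c v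
      using nz[OF that(1), of "v - (\<iota> c * \<theta> + v)"] span_diff[OF that(2,3)] by simp
    then show ?thesis by auto
  qed
  \<comment> \<open>The span is stable under scaling by \<open>c\<close>, so replacing
    \<open>v\<close> by \<open>c v\<close> lets the factor \<open>c\<close> leave the sum.\<close>
  have inner: "(\<Sum>v\<in>span ts. inverse (\<iota> c * \<theta> + v) ^ j) = \<iota> (inverse c ^ j) * powsum \<theta> ts j"
    if "c \<noteq> 0" for c
  proof -
    have "(\<Sum>v\<in>span ts. inverse (\<iota> c * \<theta> + v) ^ j) = (\<Sum>v\<in>span ts. inverse (\<iota> c * (\<theta> + v)) ^ j)"
      by (rule sum.reindex_bij_witness[of _ "\<lambda>v. \<iota> c * v" "\<lambda>v. \<iota> (inverse c) * v"])
        (use that span_scale[of _ ts c] span_scale[of _ ts "inverse c"] in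
          \<open>auto simp: algebra_simps \<iota>_inverse \<iota>_eq_0_iff\<close>)
    then show ?thesis
      by (simp add: powsum_def sum_distrib_left \<iota>_power \<iota>_inverse power_mult_distrib)
  qed
  have "(\<Sum>u\<in>span ((\<theta>, k) # ts) - {0}. inverse u ^ j)
      = (\<Sum>u\<in>?A. inverse u ^ j) + (\<Sum>u\<in>?B. inverse u ^ j)"
    unfolding decomp by (rule sum.union_disjoint) (use disj finite_span in auto)
  also have "(\<Sum>u\<in>?B. inverse u ^ j) = (\<Sum>(c, v)\<in>(- {0}) \<times> span ts. inverse (\<iota> c * \<theta> + v) ^ j)"
    by (subst sum.reindex, rule inj_on_subset[OF inj]) (auto simp: case_prod_unfold)
  also have "\<dots> = (\<Sum>c\<in>- {0}. \<iota> (inverse c ^ j) * powsum \<theta> ts j)"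
    by (simp flip: sum.cartesian_product add: inner)
  also have "\<dots> = \<iota> (\<Sum>c\<in>- {0}. inverse c ^ j) * powsum \<theta> ts j"
    by (simp add: \<iota>_sum sum_distrib_right)
  finally show ?case
    using 2(1)[OF ind 2(3)] 2(3)
    by (simp add: sum_units_power chi_def \<iota>_1 \<iota>_uminus \<iota>_0 algebra_simps)
qed auto

text \<open>In the double sum over \<open>v\<close> and \<open>w\<close> the diagonal gives weight
  \<open>a + b\<close>. Off the diagonal, partial fractions separate a pole at \<open>-v\<close> or
  \<open>-w\<close> from a power of \<open>1/(v - w)\<close>, and the sum over differences is given
  by \<open>sum_span_nonzero\<close>.\<close>

lemma powsum_mult:
  assumes ind: "independent ts" and \<theta>: "\<theta> \<notin> span ts" and ab: "a \<ge> 1" "b \<ge> 1"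
  shows "powsum \<theta> ts a * powsum \<theta> ts b = powsum \<theta> ts (a + b)
    + (\<Sum>j\<in>{1..<a+b}. \<iota> (Delta a b j) * powsum \<theta> ts (a + b - j) * ev ts [xl j 1])"
proof -
  let ?V = "span ts"
  let ?N = "\<lambda>j. \<Sum>u\<in>?V - {0}. inverse u ^ j"
  \<comment> \<open>The coefficients of \<open>partial_fraction_powers\<close> with
    \<open>a\<close>, \<open>b\<close> and \<open>j\<close> each shifted by one.\<close>
  define cA cB :: "nat \<Rightarrow> 'b" where "cA = (\<lambda>j. (- 1) ^ (j + a) * of_nat ((j - 1) choose (a - 1)))"
    and "cB = (\<lambda>j. (- 1) ^ b * of_nat ((j - 1) choose (b - 1)))"
  have nz: "\<theta> + v \<noteq> 0" if "v \<in> ?V" for v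
    using \<theta> span_uminus[OF that] by (metis eq_neg_iff_add_eq_0)
  have pf: "inverse (\<theta> + v) ^ a * inverse (\<theta> + w) ^ b = (\<Sum>j\<in>{1..<a+b}.
      (cA j * inverse (\<theta> + w) ^ (a + b - j) + cB j * inverse (\<theta> + v) ^ (a + b - j)) * inverse (v - w) ^ j)"
    if vw: "v \<in> ?V" "w \<in> ?V" "v \<noteq> w" for v w
  proof -
    have "inverse (\<theta> + v) * inverse (\<theta> + w) = inverse (v - w) * (inverse (\<theta> + w) - inverse (\<theta> + v))"
      using nz[OF vw(1)] nz[OF vw(2)] vw(3) by (simp add: field_simps)
    from partial_fraction_powers[OF this, of "a - 1" "b - 1"] ab
    have "inverse (\<theta> + v) ^ a * inverse (\<theta> + w) ^ b = (\<Sum>j\<le>a + b - 2.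
      (cA (Suc j) * inverse (\<theta> + w) ^ (a + b - Suc j) + cB (Suc j) * inverse (\<theta> + v) ^ (a + b - Suc j))
        * inverse (v - w) ^ Suc j)"
      by (cases a; cases b) (simp_all add: cA_def cB_def)
    also have "\<dots> = (\<Sum>j\<in>{1..<a+b}.
      (cA j * inverse (\<theta> + w) ^ (a + b - j) + cB j * inverse (\<theta> + v) ^ (a + b - j)) * inverse (v - w) ^ j)"
      by (rule sum.reindex_bij_witness[of _ "\<lambda>j. j - 1" Suc]) (use ab in auto)
    finally show ?thesis .
  qed
  \<comment> \<open>Translating or reflecting the span makes the inner sum independent of the fixed
    element.\<close>
  have shift1: "(\<Sum>v\<in>?V - {w}. inverse (v - w) ^ j) = ?N j" if "w \<in> ?V" for w j
    by (rule sum.reindex_bij_witness[of _ "\<lambda>u. u + w" "\<lambda>v. v - w"])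
      (use that span_add span_diff in auto)
  have shift2: "(\<Sum>w\<in>?V - {v}. inverse (v - w) ^ j) = ?N j" if "v \<in> ?V" for v j
    by (rule sum.reindex_bij_witness[of _ "\<lambda>u. v - u" "\<lambda>w. v - w"])
      (use that span_diff in auto)
  have swap: "(\<Sum>v\<in>?V. \<Sum>w\<in>?V - {v}. g v w) = (\<Sum>w\<in>?V. \<Sum>v\<in>?V - {w}. g v w)"
    for g :: "'b \<Rightarrow> 'b \<Rightarrow> 'b"
    using sum.swap_restrict[OF finite_span finite_span, where g = g and R = "\<lambda>v w. v \<noteq> w"]
    by (simp add: set_diff_eq eq_commute conj_commute)
  have "powsum \<theta> ts a * powsum \<theta> ts b
      = (\<Sum>v\<in>?V. \<Sum>w\<in>?V. inverse (\<theta> + v) ^ a * inverse (\<theta> + w) ^ b)"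
    by (simp add: powsum_def sum_product)
  also have "\<dots> = (\<Sum>v\<in>?V. inverse (\<theta> + v) ^ (a + b)
      + (\<Sum>w\<in>?V - {v}. inverse (\<theta> + v) ^ a * inverse (\<theta> + w) ^ b))"
    by (rule sum.cong) (simp_all add: sum.remove[OF finite_span] power_add)
  also have "\<dots> = powsum \<theta> ts (a + b)
      + (\<Sum>v\<in>?V. \<Sum>w\<in>?V - {v}. inverse (\<theta> + v) ^ a * inverse (\<theta> + w) ^ b)"
    by (simp add: sum.distrib powsum_def)
  also have "(\<Sum>v\<in>?V. \<Sum>w\<in>?V - {v}. inverse (\<theta> + v) ^ a * inverse (\<theta> + w) ^ b)
     = (\<Sum>v\<in>?V. \<Sum>w\<in>?V - {v}. \<Sum>j\<in>{1..<a+b}. (cA j * inverse (\<theta> + w) ^ (a + b - j)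
          + cB j * inverse (\<theta> + v) ^ (a + b - j)) * inverse (v - w) ^ j)"
    by (intro sum.cong refl pf) auto
  also have "\<dots> = (\<Sum>j\<in>{1..<a+b}. \<Sum>v\<in>?V. \<Sum>w\<in>?V - {v}. (cA j * inverse (\<theta> + w) ^ (a + b - j)
          + cB j * inverse (\<theta> + v) ^ (a + b - j)) * inverse (v - w) ^ j)"
    by (subst (2) sum.swap, subst sum.swap) (rule refl)
  also have "\<dots> = (\<Sum>j\<in>{1..<a+b}. (cA j + cB j) * powsum \<theta> ts (a + b - j) * ?N j)"
  proof (rule sum.cong[OF refl])
    fix j
    have "(\<Sum>v\<in>?V. \<Sum>w\<in>?V - {v}. (cA j * inverse (\<theta> + w) ^ (a + b - j)
          + cB j * inverse (\<theta> + v) ^ (a + b - j)) * inverse (v - w) ^ j)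
       = (\<Sum>v\<in>?V. \<Sum>w\<in>?V - {v}. cA j * inverse (\<theta> + w) ^ (a + b - j) * inverse (v - w) ^ j)
       + (\<Sum>v\<in>?V. \<Sum>w\<in>?V - {v}. cB j * inverse (\<theta> + v) ^ (a + b - j) * inverse (v - w) ^ j)"
      by (simp add: distrib_right sum.distrib)
    also have "(\<Sum>v\<in>?V. \<Sum>w\<in>?V - {v}. cA j * inverse (\<theta> + w) ^ (a + b - j) * inverse (v - w) ^ j)
       = cA j * powsum \<theta> ts (a + b - j) * ?N j"
      by (subst swap) (simp add: shift1 powsum_def flip: sum_distrib_left sum_distrib_right)
    also have "(\<Sum>v\<in>?V. \<Sum>w\<in>?V - {v}. cB j * inverse (\<theta> + v) ^ (a + b - j) * inverse (v - w) ^ j)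
       = cB j * powsum \<theta> ts (a + b - j) * ?N j"
      by (simp add: shift2 powsum_def flip: sum_distrib_left sum_distrib_right)
    finally show "(\<Sum>v\<in>?V. \<Sum>w\<in>?V - {v}. (cA j * inverse (\<theta> + w) ^ (a + b - j)
          + cB j * inverse (\<theta> + v) ^ (a + b - j)) * inverse (v - w) ^ j)
        = (cA j + cB j) * powsum \<theta> ts (a + b - j) * ?N j"
      by (simp add: distrib_right)
  qed
  also have "\<dots> = (\<Sum>j\<in>{1..<a+b}. \<iota> (Delta a b j) * powsum \<theta> ts (a + b - j) * ev ts [xl j 1])"
  proof (rule sum.cong[OF refl])
    fix j assume j: "j \<in> {1..<a+b}"
    show "(cA j + cB j) * powsum \<theta> ts (a + b - j) * ?N j
        = \<iota> (Delta a b j) * powsum \<theta> ts (a + b - j) * ev ts [xl j 1]"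
    proof (cases "(CARD('a) - 1) dvd j")
      case True
      \<comment> \<open>This removes \<open>j\<close> from the sign in \<open>cA\<close>. The
        remaining signs give \<open>- Delta\<close>, whose minus cancels the one in
        \<open>sum_span_nonzero\<close>.\<close>
      have "(- 1 :: 'a) ^ j = 1"
        using True finite_field_power_card_minus_one[of "- 1 :: 'a"]
        by (auto simp: power_mult simp del: One_nat_def)
      then have "(- 1 :: 'b) ^ j = 1"
        using \<iota>_power[of "- 1" j] by (simp add: \<iota>_uminus \<iota>_1)
      then have "cA j + cB j = - \<iota> (Delta a b j)"
        using True ab by (cases a; cases b) (simp_all add: cA_def cB_def Delta_def power_add \<iota>_add \<iota>_mult \<iota>_power \<iota>_uminus
            \<iota>_1 \<iota>_of_nat)
      then show ?thesis using sum_span_nonzero[OF ind, of j] j True by simp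
    next
      case False
      then show ?thesis using sum_span_nonzero[OF ind, of j] j by (simp add: Delta_def \<iota>_0)
    qed
  qed
  finally show ?thesis .
qed

section \<open>Multiplicativity on words\<close>

text \<open>All leading letters in \<open>dmStep\<close> have the same sign, so their character
  factors out and \<open>powsum_mult\<close> remains. Leaving \<open>\<phi> []\<close> open covers
  both \<open>top_ev\<close> and the increment of \<open>ev\<close> when a pair is added.\<close>

lemma lin_chi_dmStep:
  assumes hom: "\<And>u v. length u + length v \<le> n \<Longrightarrow> lin (ev ts) (shF n u v) = ev ts u * ev ts v"
    and ind: "independent ts" and \<theta>: "\<theta> \<notin> span ts" and len: "length a + length b < n"
    and \<phi>: "\<And>z w. \<phi> (z # w) = chi \<theta> k ts z * ev ts w"
  shows "lin \<phi> (dmStep (shF n) x a y b) = chi \<theta> k ts x * ev ts a * (chi \<theta> k ts y * ev ts b)"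
proof -
  let ?t = "shF n a b" and ?e = "sg x * sg y"
  have t: "lin (ev ts) ?t = ev ts a * ev ts b" using hom len by simp
  have pre: "lin \<phi> (pre z p) = chi \<theta> k ts z * lin (ev ts) p" for z p
    by (simp add: lin_pre \<phi> lin_fun_cmult)
  have b: "lin (ev ts) (bilin (shF n) (Poly_Mapping.single [z] 1) ?t) = ev ts [z] * (ev ts a * ev ts b)" for z
  proof -
    have "lin (ev ts) (bilin (shF n) (Poly_Mapping.single [z] 1) ?t)
        = lin (ev ts) (Poly_Mapping.single [z] 1) * lin (ev ts) ?t"
      \<comment> \<open>A letter and a word of \<open>shF n a b\<close> have total length at most
        \<open>length a + length b + 1\<close>, hence at most \<open>n\<close>.\<close>
      by (rule lin_bilin, rule hom) (use keys_shF_subset[of n a b] len in auto)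
    then show ?thesis by (simp add: t \<iota>_1)
  qed
  have e: "?e \<noteq> 0" by (simp add: sg_nonzero)
  note wx = wt_ge_1[of x] and wy = wt_ge_1[of y]
  have "lin \<phi> (dmStep (shF n) x a y b) = chi \<theta> k ts (xl (wt x + wt y) ?e) * (ev ts a * ev ts b)
      + (\<Sum>j\<in>{1..<wt x + wt y}. \<iota> (Delta (wt x) (wt y) j) * (chi \<theta> k ts (xl (wt x + wt y - j) ?e)
          * (ev ts [xl j 1] * (ev ts a * ev ts b))))"
    by (simp add: dmStep_def Let_def lin_add lin_sum lin_scal pre t b del: ev.simps)
  also have "\<dots> = \<iota> ?e ^ k * (powsum \<theta> ts (wt x + wt y) + (\<Sum>j\<in>{1..<wt x + wt y}.
      \<iota> (Delta (wt x) (wt y) j) * powsum \<theta> ts (wt x + wt y - j) * ev ts [xl j 1])) * (ev ts a * ev ts b)"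
    unfolding distrib_left distrib_right sum_distrib_left sum_distrib_right
    using wx wy e by (intro arg_cong2[of _ _ _ _ "(+)"] sum.cong refl) (simp_all add: chi_def mult_ac del: ev.simps)
  also have "\<dots> = \<iota> ?e ^ k * (powsum \<theta> ts (wt x) * powsum \<theta> ts (wt y)) * (ev ts a * ev ts b)"
    by (simp only: powsum_mult[OF ind \<theta> wx wy])
  finally show ?thesis
    by (simp add: chi_def \<iota>_mult power_mult_distrib mult_ac)
qed

text \<open>Adding a pair changes \<open>ev ts\<close> by \<open>\<tau>\<close>. In the expanded
  product of two such sums, the two mixed terms match the \<open>pre\<close> terms of the shuffle,
  the product of increments matches \<open>dmStep\<close>, and the rest is the induction
  hypothesis.\<close>

lemma lin_ev_shF:
  assumes "independent ts" "length u + length v \<le> n"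
  shows "lin (ev ts) (shF n u v) = ev ts u * ev ts v"
  using assms
proof (induction ts arbitrary: n u v)
  case Nil
  \<comment> \<open>\<open>ev []\<close> kills nonempty words, and the recursive case produces only
    prefixed ones.\<close>
  have pre0: "lin (ev []) (pre x p) = 0" for x p
    unfolding lin_pre by (simp add: lin_def)
  show ?case
    using Nil.prems by (cases "(n, u, v)" rule: shF.cases)
      (auto simp: \<iota>_1 lin_add lin_sum lin_scal dmStep_def Let_def pre0)
next
  case (Cons t ts)
  obtain \<theta> k where t: "t = (\<theta>, k)" by (cases t)
  have ind: "independent ts" and \<theta>: "\<theta> \<notin> span ts" using Cons.prems t by auto
  define \<tau> where "\<tau> w = ev (t # ts) w - ev ts w" for w
  have \<tau>: "\<tau> (z # w) = chi \<theta> k ts z * ev ts w" for z w by (simp add: \<tau>_def t)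
  have split: "lin (ev (t # ts)) p = lin (ev ts) p + lin \<tau> p" for p
    using lin_fun_add[of "ev ts" \<tau> p] by (simp add: \<tau>_def)
  have pre: "lin \<tau> (pre z p) = chi \<theta> k ts z * lin (ev ts) p" for z p
    by (simp add: lin_pre \<tau> lin_fun_cmult)
  note IH = Cons.IH[OF ind]
  show ?case
    using Cons.prems(2)
  proof (cases "(n, u, v)" rule: shF.cases)
    case (4 m x a y b)
    have d: "lin \<tau> (dmStep (shF m) x a y b) = chi \<theta> k ts x * ev ts a * (chi \<theta> k ts y * ev ts b)"
      by (rule lin_chi_dmStep[OF _ ind \<theta> _ \<tau>]) (use IH Cons.prems(2) 4 in auto)
    have "lin (ev (t # ts)) (shF n u v) = lin (ev ts) (shF n u v) + lin \<tau> (shF n u v)"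
      by (rule split)
    also have "lin \<tau> (shF n u v) = chi \<theta> k ts x * (ev ts a * ev ts v) + chi \<theta> k ts y * (ev ts u * ev ts b)
        + chi \<theta> k ts x * ev ts a * (chi \<theta> k ts y * ev ts b)"
      using 4 Cons.prems(2) by (simp add: lin_add pre d IH)
    also have "lin (ev ts) (shF n u v) = ev ts u * ev ts v" using IH Cons.prems(2) by simp
    finally show ?thesis using 4 t by (simp add: algebra_simps)
  qed (auto simp: \<iota>_1)
qed

lemma lin_top_ev_dmw:
  assumes "independent ((\<theta>, k) # ts)"
  shows "lin (top_ev \<theta> k ts) (dmw u v) = top_ev \<theta> k ts u * top_ev \<theta> k ts v"
proof (cases u)
  case Nil
  then show ?thesis by (simp add: dmw_def \<iota>_1)
next
  case u: (Cons x a)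
  show ?thesis
  proof (cases v)
    case Nil
    then show ?thesis by (simp add: u dmw_def \<iota>_1)
  next
    case v: (Cons y b)
    show ?thesis
      unfolding u v dmw_def
      \<comment> \<open>The fuel left for the inner shuffles is
        \<open>length a + length b + 1\<close>.\<close>
      by (simp, rule lin_chi_dmStep) (use assms in \<open>auto intro: lin_ev_shF\<close>)
  qed
qed

section \<open>Separation\<close>

text \<open>Clearing denominators gives a polynomial in \<open>\<theta>\<close> with infinitely many roots; its value at \<open>0\<close>
  only sees the pole of highest order, that is, the leading coefficient.\<close>

lemma powsum_independent:
  assumes fin: "finite I" and pos: "\<And>n. n \<in> I \<Longrightarrow> n \<ge> 1"
    and eq: "\<And>\<theta>. \<theta> \<notin> span ts \<Longrightarrow> c0 + (\<Sum>n\<in>I. c n * powsum \<theta> ts n) = 0"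
    and m: "m \<in> I"
  shows "c m = 0"
proof (rule ccontr)
  assume "c m \<noteq> 0"
  define J where "J = {n \<in> I. c n \<noteq> 0}"
  have finJ: "finite J" and J: "J \<noteq> {}" using fin m \<open>c m \<noteq> 0\<close> by (auto simp: J_def)
  define N where "N = Max J"
  have N: "N \<in> J" "\<And>n. n \<in> J \<Longrightarrow> n \<le> N" using finJ J by (auto simp: N_def)
  have "N \<ge> 1" using N(1) pos by (auto simp: J_def)
  let ?V = "span ts"
  \<comment> \<open>The relation \<open>eq\<close> times the common denominator;
    \<open>n \<le> N\<close> on \<open>J\<close> makes every exponent \<open>N - n\<close> a true
    difference.\<close>
  define Q where "Q = smult c0 (\<Prod>w\<in>?V. [:w, 1:] ^ N)
    + (\<Sum>n\<in>J. smult (c n) (\<Sum>v\<in>?V. (\<Prod>w\<in>?V - {v}. [:w, 1:] ^ N) * [:v, 1:] ^ (N - n)))"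
  have root: "poly Q \<theta> = 0" if "\<theta> \<notin> ?V" for \<theta>
  proof -
    have nz: "\<theta> + v \<noteq> 0" if "v \<in> ?V" for v
      using \<open>\<theta> \<notin> ?V\<close> span_uminus[OF that] by (metis eq_neg_iff_add_eq_0)
    let ?D = "\<Prod>w\<in>?V. (\<theta> + w) ^ N"
    have pole: "(\<Prod>w\<in>?V - {v}. (\<theta> + w) ^ N) * (\<theta> + v) ^ (N - n) = ?D * inverse (\<theta> + v) ^ n"
      if "v \<in> ?V" "n \<in> J" for v n
    proof -
      have "?D = (\<theta> + v) ^ N * (\<Prod>w\<in>?V - {v}. (\<theta> + w) ^ N)"
        by (rule prod.remove[OF finite_span that(1)])
      moreover have "(\<theta> + v) ^ N * inverse (\<theta> + v) ^ n = (\<theta> + v) ^ (N - n)"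
        using nz[OF that(1)] N(2)[OF that(2)] by (simp add: power_diff power_inverse divide_inverse)
      ultimately show ?thesis by (simp add: mult_ac)
    qed
    have "poly Q \<theta> = c0 * ?D + (\<Sum>n\<in>J. c n * (\<Sum>v\<in>?V. ?D * inverse (\<theta> + v) ^ n))"
      by (simp add: Q_def poly_prod poly_sum add.commute[of _ \<theta>] pole)
    also have "\<dots> = ?D * (c0 + (\<Sum>n\<in>J. c n * powsum \<theta> ts n))"
      by (simp add: powsum_def distrib_left sum_distrib_left mult_ac)
    also have "(\<Sum>n\<in>J. c n * powsum \<theta> ts n) = (\<Sum>n\<in>I. c n * powsum \<theta> ts n)"
      by (rule sum.mono_neutral_left) (use fin in \<open>auto simp: J_def\<close>)
    finally show ?thesis using eq[OF that] by simp
  qed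
  have "infinite (- ?V)"
    using infinite_UNIV finite_span[of ts] by (simp add: Compl_eq_Diff_UNIV)
  then have "Q = 0"
    using poly_roots_finite[of Q] root finite_subset[of "- ?V" "{\<theta>. poly Q \<theta> = 0}"] by blast
  \<comment> \<open>The point 0 lies in the span, where \<open>eq\<close> says nothing, but
    \<open>Q = 0\<close> holds there too. Every product containing the factor for
    \<open>w = 0\<close> vanishes, which leaves \<open>v = 0\<close> and then
    \<open>n = N\<close>.\<close>
  define P where "P = (\<Prod>w\<in>?V - {0}. w ^ N)"
  have 1: "(\<Prod>w\<in>A. w ^ N) = 0" if "0 \<in> A" "finite A" for A :: "'b set"
    using that \<open>N \<ge> 1\<close> by (auto intro!: prod_zero bexI[of _ 0])
  have "(\<Sum>v\<in>?V. (\<Prod>w\<in>?V - {v}. w ^ N) * v ^ (N - n)) = P * 0 ^ (N - n)" for n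
  proof -
    have "(\<Sum>v\<in>?V - {0}. (\<Prod>w\<in>?V - {v}. w ^ N) * v ^ (N - n)) = 0"
      by (rule sum.neutral) (use \<open>N \<ge> 1\<close> in \<open>auto intro!: 1 simp: zero_in_span finite_span\<close>)
    then show ?thesis
      by (simp add: sum.remove[OF finite_span zero_in_span] P_def)
  qed
  then have "poly Q 0 = (\<Sum>n\<in>J. c n * (P * 0 ^ (N - n)))"
    by (simp add: Q_def poly_prod poly_sum 1[OF zero_in_span finite_span])
  also have "\<dots> = (\<Sum>n\<in>J. if n = N then c N * P else 0)"
    by (intro sum.cong) (use N in \<open>auto dest: le_neq_implies_less\<close>)
  also have "\<dots> = c N * P" using N finJ by simp
  finally have "c N * P = 0" using \<open>Q = 0\<close> by simp
  moreover have "P \<noteq> 0" by (simp add: P_def finite_span)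
  ultimately show False using N(1) by (simp add: J_def)
qed

section \<open>Peeling off first letters\<close>

lemma lin_first_letter:
  assumes X: "finite X" "\<And>x w. x # w \<in> Poly_Mapping.keys p \<Longrightarrow> x \<in> X"
    and \<phi>: "\<And>z w. \<phi> (z # w) = g z * \<psi> w"
  shows "lin \<phi> p = \<iota> (Poly_Mapping.lookup p []) * \<phi> [] + (\<Sum>x\<in>X. g x * lin \<psi> (tail x p))"
  by (subst decompose_by_first_letter[OF X]) (simp_all add: lin_add lin_sum lin_pre \<phi> lin_fun_cmult)

text \<open>Grouping words by the weight of the first letter gives a relation between 1 and power
  sums. \<open>powsum_independent\<close> isolates each weight; varying \<open>k\<close>,
  \<open>vanishing_power_sums\<close> then isolates each sign.\<close>

lemma lin_ev_tail_eq_0: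
  assumes zero: "\<And>\<theta> k. \<theta> \<notin> span ts \<Longrightarrow> lin (\<phi> \<theta> k) p = 0"
    and \<phi>: "\<And>\<theta> k. \<phi> \<theta> k [] = d" "\<And>\<theta> k z w. \<phi> \<theta> k (z # w) = chi \<theta> k ts z * ev ts w"
  shows "lin (ev ts) (tail x p) = 0"
proof -
  \<comment> \<open>If the empty word occurs, \<open>X\<close> also contains the unspecified
    \<open>hd []\<close>; a finite superset of the first letters is enough.\<close>
  define X where "X = hd ` Poly_Mapping.keys p"
  have X: "finite X" "\<And>x w. x # w \<in> Poly_Mapping.keys p \<Longrightarrow> x \<in> X"
    by (force simp: X_def)+
  let ?L = "\<lambda>x. lin (ev ts) (tail x p)"
  show ?thesis
  proof (cases "x \<in> X")
    case True
    have "(\<Sum>x\<in>{x \<in> X. wt x = n}. \<iota> (sg x) ^ k * ?L x) = 0" if n: "n \<in> wt ` X" for n k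
    proof (rule powsum_independent[where I = "wt ` X" and ts = ts])
      fix \<theta> assume \<theta>: "\<theta> \<notin> span ts"
      have "(\<Sum>n\<in>wt ` X. (\<Sum>x\<in>{x \<in> X. wt x = n}. \<iota> (sg x) ^ k * ?L x) * powsum \<theta> ts n)
          = (\<Sum>n\<in>wt ` X. \<Sum>x\<in>{x \<in> X. wt x = n}. chi \<theta> k ts x * ?L x)"
        unfolding sum_distrib_right by (intro sum.cong refl) (auto simp: chi_def mult_ac)
      also have "\<dots> = (\<Sum>x\<in>X. chi \<theta> k ts x * ?L x)"
        by (rule sum.group) (use X in auto)
      finally show "\<iota> (Poly_Mapping.lookup p []) * d
          + (\<Sum>n\<in>wt ` X. (\<Sum>x\<in>{x \<in> X. wt x = n}. \<iota> (sg x) ^ k * ?L x) * powsum \<theta> ts n) = 0"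
        using zero[OF \<theta>, of k] lin_first_letter[where \<phi> = "\<phi> \<theta> k", OF X \<phi>(2)] by (simp add: \<phi>(1))
    qed (use X n wt_ge_1 in auto)
    then show ?thesis
      using True
      by (intro vanishing_power_sums[of "{z \<in> X. wt z = wt x}" "\<lambda>z. \<iota> (sg z)" ?L])
        (use X in \<open>auto simp: inj_on_def \<iota>_eq_iff intro: letter_eqI\<close>)
  next
    case False
    then have "tail x p = 0" using X(2) by (intro poly_mapping_eqI) (auto simp: in_keys_iff)
    then show ?thesis by simp
  qed
qed

text \<open>\<open>ev []\<close> reads off the coefficient of the empty word. Differences of
  \<open>ev\<close> for a list and its extension also annihilate \<open>p\<close>, so every tail
  inherits the hypothesis.\<close>

lemma ev_separates:
  assumes "\<And>ts. independent ts \<Longrightarrow> lin (ev ts) p = 0"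
  shows "p = 0"
proof (rule poly_mapping_eqI)
  fix w
  show "Poly_Mapping.lookup p w = Poly_Mapping.lookup 0 w"
    using assms
  proof (induction w arbitrary: p)
    case Nil
    have "finite (hd ` Poly_Mapping.keys p)" "x # w \<in> Poly_Mapping.keys p \<Longrightarrow> x \<in> hd ` Poly_Mapping.keys p" for x w
      by force+
    then have "lin (ev []) p = \<iota> (Poly_Mapping.lookup p [])"
      using lin_first_letter[of "hd ` Poly_Mapping.keys p" p "ev []" "\<lambda>_. 0" "\<lambda>_. 0"] by simp
    then show ?case using Nil[of "[]"] by (simp add: \<iota>_eq_0_iff)
  next
    case (Cons x w)
    have "lin (ev ts) (tail x p) = 0" if ts: "independent ts" for ts
    proof (rule lin_ev_tail_eq_0[where \<phi> = "\<lambda>\<theta> k w. ev ((\<theta>, k) # ts) w - ev ts w" and d = 0])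
      fix \<theta> :: 'b and k :: nat
      assume "\<theta> \<notin> span ts"
      then have "lin (ev ((\<theta>, k) # ts)) p = 0" "lin (ev ts) p = 0" using Cons.prems ts by auto
      then show "lin (\<lambda>w. ev ((\<theta>, k) # ts) w - ev ts w) p = 0"
        using lin_fun_add[of "\<lambda>w. ev ((\<theta>, k) # ts) w - ev ts w" "ev ts" p] by simp
    qed simp_all
    then show ?case using Cons.IH[of "tail x p"] by simp
  qed
qed

lemma top_ev_separates:
  assumes zero: "\<And>\<theta> k ts. independent ((\<theta>, k) # ts) \<Longrightarrow> lin (top_ev \<theta> k ts) p = 0"
  shows "p = 0"
proof -
  have tail: "tail x p = 0" for x
  proof (rule ev_separates)
    fix ts assume "independent ts"
    then show "lin (ev ts) (tail x p) = 0"
      by (intro lin_ev_tail_eq_0[where \<phi> = "\<lambda>\<theta> k. top_ev \<theta> k ts" and d = 1]) (auto intro: zero)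
  qed
  have "p = Poly_Mapping.single [] (Poly_Mapping.lookup p []) + (\<Sum>x\<in>hd ` Poly_Mapping.keys p. pre x (tail x p))"
    by (rule decompose_by_first_letter) force+
  then have p: "p = Poly_Mapping.single [] (Poly_Mapping.lookup p [])"
    by (simp add: tail pre_def)
  \<comment> \<open>\<open>1\<close> lies outside \<open>span [] = {0}\<close>, and
    \<open>top_ev\<close> is 1 on the empty word.\<close>
  have "lin (top_ev 1 0 []) p = 0" by (rule zero) simp
  then have "Poly_Mapping.lookup p [] = 0" by (subst (asm) p) (simp add: \<iota>_eq_0_iff)
  then show ?thesis using p by simp
qed

section \<open>Transfer of the algebra laws\<close>

lemma comm_algebra_shuffle: "comm_algebra (shuffle :: 'a D \<Rightarrow> 'a D \<Rightarrow> 'a D) unitD"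
  unfolding shuffle_def
proof (rule comm_algebra_bilinI[where \<Phi> = "{ev ts |ts. independent ts}"])
  show "p = 0" if "\<And>\<phi>. \<phi> \<in> {ev ts |ts. independent ts} \<Longrightarrow> lin \<phi> p = 0" for p
    using that by (intro ev_separates) blast
qed (auto simp: shw_def intro: lin_ev_shF)

lemma comm_algebra_diamond: "comm_algebra (diamond :: 'a D \<Rightarrow> 'a D \<Rightarrow> 'a D) unitD"
  unfolding diamond_def
proof (rule comm_algebra_bilinI[where \<Phi> = "{top_ev \<theta> k ts |\<theta> k ts. independent ((\<theta>, k) # ts)}"])
  show "p = 0" if "\<And>\<phi>. \<phi> \<in> {top_ev \<theta> k ts |\<theta> k ts. independent ((\<theta>, k) # ts)} \<Longrightarrow> lin \<phi> p = 0" for p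
    using that by (intro top_ev_separates) blast
qed (auto intro: lin_top_ev_dmw)

end

text \<open>The rational function field F_q(X) serves as L; it is infinite because the powers of X
  are distinct.\<close>

lemma field_extension_fract_poly:
  "field_extension (\<lambda>c::'a::{field,finite}. to_fract [:c:])"
proof
  have "inj (\<lambda>n. monom (1::'a) n)" by (rule injI) (metis degree_monom_eq one_neq_zero)
  then have "inj (\<lambda>n. to_fract (monom (1::'a) n))" by (simp add: inj_def)
  then show "infinite (UNIV :: 'a poly fract set)"
    by (metis finite_imageD finite_subset infinite_UNIV_nat subset_UNIV)
qed (simp_all flip: to_fract_add to_fract_mult one_pCons)

theorem theorem5p9:
  shows "comm_algebra (diamond :: 'a::{field,finite} D \<Rightarrow> 'a D \<Rightarrow> 'a D) unitD
       \<and> comm_algebra (shuffle :: 'a D \<Rightarrow> 'a D \<Rightarrow> 'a D) unitD"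
proof -
  interpret field_extension "\<lambda>c::'a. to_fract [:c:]" by (rule field_extension_fract_poly)
  show ?thesis using comm_algebra_diamond comm_algebra_shuffle by blast
qed

end
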